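(* Let $p_1,p_3,p_4$ be distinct primes and $\hat{\mathbf{K}}=(\hat K,\leq_p)$ as in the context. Then $\hat{\mathbf{K}}$ is pseudo-universal. In particular, $\hat{\mathbf{K}}$ is $(<\aleph_0)$-tame.
   Context: For an abelian group $G$ and prime $p$, $p^\omega G:=\bigcap_{n\geq 0}p^nG$. $H\leq_p G$ means $H$ is a pure subgroup: $nH=H\cap nG$ for all integers $n$. $\hat K_1$ is the class of torsion-free abelian groups $G$ with $G=p_1^\omega G$ and $p^\omega G=0$ for all primes $p\neq p_1$. $\hat K_2$ is the class of torsion-free abelian groups $G$ such that (a) for every $g\in p_1^\omega G$ there is at most one $z\in p_3^\omega G$ with $g+z\in p_4^\omega G$, and (b) for every $g\in p_1^\omega G$ there exist an integer $k>0$ and $z\in p_3^\omega G$ with $kg+z\in p_4^\omega G$. $\hat K=\hat K_1\cup\hat K_2$; $\hat{\mathbf{K}}$ is an AEC that admits intersections, with $\operatorname{cl}^N(A):=\bigcap\{M: A\subseteq M\leq_p N, M\in\hat K\}$ for $N\in\hat K$, $A\subseteq N$. An AEC $\mathbf K$ admitting intersections is pseudo-universal if for all $N_1,N_2\in K$ and finite tuples $\bar a_1\in N_1$, $\bar a_2\in N_2$, whenever $f,g:\operatorname{cl}^{N_1}(\bar a_1)\to\operatorname{cl}^{N_2}(\bar a_2)$ are isomorphisms with $f(\bar a_1)=g(\bar a_1)=\bar a_2$, then $f=g$. Galois types (for an AEC admitting intersections): for $N_1,N_2\in K$, $A\subseteq N_1\cap N_2$, $b_i\in N_i$, $\mathbf{gtp}(b_1/A;N_1)=\mathbf{gtp}(b_2/A;N_2)$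 iff there is an isomorphism $f:\operatorname{cl}^{N_1}(\{b_1\}\cup A)\cong\operatorname{cl}^{N_2}(\{b_2\}\cup A)$ with $f\restriction A=\mathrm{id}_A$ and $f(b_1)=b_2$. $\mathbf K$ is $(<\aleph_0)$-tame if for every $M\in K$, whenever $\mathbf{gtp}(b_1/M;N_1)\neq\mathbf{gtp}(b_2/M;N_2)$ there is a finite $A\subseteq M$ with $\mathbf{gtp}(b_1/A;N_1)\neq\mathbf{gtp}(b_2/A;N_2)$. *)

theory Defs
  imports "HOL-Algebra.Group" "HOL-Computational_Algebra.Primes"
begin

(* Abelian groups are HOL-Algebra's comm_group, hence written multiplicatively:
   the additive n g is g [^] n, and g + z is g \<otimes> z. *)

section \<open>Abelian groups\<close>

definition mult_image :: "('a, 'b) monoid_scheme \<Rightarrow> int \<Rightarrow> 'a set \<Rightarrow> 'a set" where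
  "mult_image G n H = (\<lambda>x. x [^]\<^bsub>G\<^esub> n) ` H"

definition p_omega :: "nat \<Rightarrow> ('a, 'b) monoid_scheme \<Rightarrow> 'a set" where
  "p_omega p G = (\<Inter>n::nat. mult_image G (int p ^ n) (carrier G))"

definition torsion_free :: "('a, 'b) monoid_scheme \<Rightarrow> bool" where
  "torsion_free G \<longleftrightarrow>
     (\<forall>x\<in>carrier G. \<forall>n::int. n > 0 \<longrightarrow> x [^]\<^bsub>G\<^esub> n = \<one>\<^bsub>G\<^esub> \<longrightarrow> x = \<one>\<^bsub>G\<^esub>)"

definition pure_subgroup :: "'a set \<Rightarrow> ('a, 'b) monoid_scheme \<Rightarrow> bool" where
  "pure_subgroup H G \<longleftrightarrow>
     subgroup H G \<and> (\<forall>n::int. mult_image G n H = H \<inter> mult_image G n (carrier G))"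

(* The ordering relates structures rather than carrier sets, so the operations of M are
   required to be those of N on the carrier of M. *)
definition pure_le :: "'a monoid \<Rightarrow> 'a monoid \<Rightarrow> bool" (infix "\<le>\<^sub>p" 50) where
  "M \<le>\<^sub>p N \<longleftrightarrow>
     pure_subgroup (carrier M) N \<and> \<one>\<^bsub>M\<^esub> = \<one>\<^bsub>N\<^esub> \<and>
     (\<forall>x\<in>carrier M. \<forall>y\<in>carrier M. x \<otimes>\<^bsub>M\<^esub> y = x \<otimes>\<^bsub>N\<^esub> y)"

definition K1_hat :: "nat \<Rightarrow> 'a monoid set" where
  "K1_hat p1 = {G. comm_group G \<and> torsion_free G \<and> carrier G = p_omega p1 G \<and>
     (\<forall>p::nat. prime p \<longrightarrow> p \<noteq> p1 \<longrightarrow> p_omega p G = {\<one>\<^bsub>G\<^esub>})}"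

definition K2_hat :: "nat \<Rightarrow> nat \<Rightarrow> nat \<Rightarrow> 'a monoid set" where
  "K2_hat p1 p3 p4 = {G. comm_group G \<and> torsion_free G \<and>
     (\<forall>g\<in>p_omega p1 G. \<forall>z\<in>p_omega p3 G. \<forall>z'\<in>p_omega p3 G.
        g \<otimes>\<^bsub>G\<^esub> z \<in> p_omega p4 G \<longrightarrow> g \<otimes>\<^bsub>G\<^esub> z' \<in> p_omega p4 G \<longrightarrow> z = z') \<and>
     (\<forall>g\<in>p_omega p1 G. \<exists>k::int. k > 0 \<and>
        (\<exists>z\<in>p_omega p3 G. (g [^]\<^bsub>G\<^esub> k) \<otimes>\<^bsub>G\<^esub> z \<in> p_omega p4 G))}"

definition K_hat :: "nat \<Rightarrow> nat \<Rightarrow> nat \<Rightarrow> 'a monoid set" where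
  "K_hat p1 p3 p4 = K1_hat p1 \<union> K2_hat p1 p3 p4"

section \<open>Classes admitting intersections, in the language of groups\<close>

(* Below, K is a class of structures with elements in an arbitrary type 'a and leK is its
   ordering.  Fixing one type for all structures loses nothing when 'a is a type variable,
   since any two structures have isomorphic copies in the sum of their types. *)

definition cl :: "'a monoid set \<Rightarrow> ('a monoid \<Rightarrow> 'a monoid \<Rightarrow> bool) \<Rightarrow> 'a monoid \<Rightarrow> 'a set \<Rightarrow> 'a monoid"
  where
  "cl K leK N A = N\<lparr>carrier := \<Inter>{carrier M | M. M \<in> K \<and> leK M N \<and> A \<subseteq> carrier M}\<rparr>"

definition pseudo_universal :: "'a monoid set \<Rightarrow> ('a monoid \<Rightarrow> 'a monoid \<Rightarrow> bool) \<Rightarrow> bool" where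
  "pseudo_universal K leK \<longleftrightarrow>
     (\<forall>N1\<in>K. \<forall>N2\<in>K. \<forall>a1 a2 :: 'a list. \<forall>f g.
        set a1 \<subseteq> carrier N1 \<longrightarrow> set a2 \<subseteq> carrier N2 \<longrightarrow>
        f \<in> iso (cl K leK N1 (set a1)) (cl K leK N2 (set a2)) \<longrightarrow>
        g \<in> iso (cl K leK N1 (set a1)) (cl K leK N2 (set a2)) \<longrightarrow>
        map f a1 = a2 \<longrightarrow> map g a1 = a2 \<longrightarrow>
        (\<forall>x\<in>carrier (cl K leK N1 (set a1)). f x = g x))"

text \<open>Equality of the Galois types of b1 over A in N1 and of b2 over A in N2.\<close>

definition gtp_eq :: "'a monoid set \<Rightarrow> ('a monoid \<Rightarrow> 'a monoid \<Rightarrow> bool) \<Rightarrow>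
    'a set \<Rightarrow> 'a \<Rightarrow> 'a monoid \<Rightarrow> 'a \<Rightarrow> 'a monoid \<Rightarrow> bool" where
  "gtp_eq K leK A b1 N1 b2 N2 \<longleftrightarrow>
     (\<exists>f \<in> iso (cl K leK N1 (insert b1 A)) (cl K leK N2 (insert b2 A)).
        (\<forall>a\<in>A. f a = a) \<and> f b1 = b2)"

(* As for types over sets, M is only required to be contained in N1 and N2; this includes
   the case where M is below N1 and N2 in the ordering. *)
definition finitely_tame :: "'a monoid set \<Rightarrow> ('a monoid \<Rightarrow> 'a monoid \<Rightarrow> bool) \<Rightarrow> bool" where
  "finitely_tame K leK \<longleftrightarrow>
     (\<forall>M\<in>K. \<forall>N1\<in>K. \<forall>N2\<in>K. \<forall>b1\<in>carrier N1. \<forall>b2\<in>carrier N2.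
        carrier M \<subseteq> carrier N1 \<inter> carrier N2 \<longrightarrow>
        \<not> gtp_eq K leK (carrier M) b1 N1 b2 N2 \<longrightarrow>
        (\<exists>A. finite A \<and> A \<subseteq> carrier M \<and> \<not> gtp_eq K leK A b1 N1 b2 N2))"

end

theory Submission
  imports Defs "HOL-Algebra.Generated_Groups"
begin

text \<open>
  In a group \<open>N\<close> of the class, the element \<open>z\<close> with \<open>g + z \<in> p\<^sub>4\<^sup>\<omega> N\<close> is unique: this is
  condition (a) for the second subclass, and \<open>p\<^sub>3\<^sup>\<omega> N = 0\<close> for the first. Hence the pure
  subgroups of \<open>N\<close> that belong to the class are closed under intersections and directed
  unions. If two homomorphisms from the closure of \<open>A\<close> to a group of the class agree on \<open>A\<close>,
  their equalizer is pure by torsion-freeness and, by uniqueness of \<open>z\<close>, belongs to the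
  class; so it is the whole closure. For tameness, rigidity makes the isomorphisms between
  closures of finite sets compatible, and they glue because the closure is finitary.
\<close>

section \<open>Pure subgroups of torsion-free groups\<close>

lemma torsion_freeD:
  assumes "torsion_free G" "x \<in> carrier G" "(n::int) > 0" "x [^]\<^bsub>G\<^esub> n = \<one>\<^bsub>G\<^esub>"
  shows "x = \<one>\<^bsub>G\<^esub>"
  using assms unfolding torsion_free_def by blast

lemma (in comm_group) torsion_free_pow_inj:
  assumes "torsion_free G" "x \<in> carrier G" "y \<in> carrier G" "(n::int) > 0" "x [^] n = y [^] n"
  shows "x = y"
proof -
  have "(x \<otimes> inv y) [^] n = \<one>"
    using assms by (simp add: int_pow_distrib int_pow_inv)
  then have "x \<otimes> inv y = \<one>"
    using torsion_freeD[OF assms(1) _ assms(4)] assms by simp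
  then show ?thesis
    using assms by (simp add: inv_solve_right')
qed

text \<open>Roots are unique in a torsion-free group, so an element of \<open>S\<close> divisible in
  \<open>G\<close> is divisible in \<open>S\<close> exactly when its ambient root lies in
  \<open>S\<close>. In this form purity visibly survives intersections, directed unions and
  equalizers.\<close>

lemma (in comm_group) pure_subgroup_iff:
  assumes tf: "torsion_free G"
  shows "pure_subgroup S G \<longleftrightarrow>
    subgroup S G \<and> (\<forall>n::int. n > 0 \<longrightarrow> (\<forall>y\<in>carrier G. y [^] n \<in> S \<longrightarrow> y \<in> S))"
proof (intro iffI conjI allI impI ballI)
  assume S: "pure_subgroup S G"
  then show "subgroup S G" by (simp add: pure_subgroup_def)
  fix n :: int and y assume n: "n > 0" "y \<in> carrier G" "y [^] n \<in> S"
  then have "y [^] n \<in> mult_image G n S"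
    using S by (auto simp: pure_subgroup_def mult_image_def)
  then obtain x where x: "x \<in> S" "y [^] n = x [^] n" by (auto simp: mult_image_def)
  then have "y = x"
    using torsion_free_pow_inj[OF tf n(2) _ n(1)] subgroup.mem_carrier[OF \<open>subgroup S G\<close>] by simp
  then show "y \<in> S" using x by simp
next
  assume S: "subgroup S G \<and> (\<forall>n::int. n > 0 \<longrightarrow> (\<forall>y\<in>carrier G. y [^] n \<in> S \<longrightarrow> y \<in> S))"
  then have sub: "subgroup S G" by blast
  \<comment> \<open>Negative exponents reduce to positive ones, because \<open>S\<close> is closed
    under inverses.\<close>
  have root: "y \<in> S" if "n \<noteq> 0" "y \<in> carrier G" "y [^] n \<in> S" for n :: int and y
  proof (cases "n > 0")
    case False
    have "y [^] (- n) \<in> S"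
      using that subgroup.m_inv_closed[OF sub] by (simp add: int_pow_neg)
    moreover have "- n > 0" using that False by simp
    ultimately show ?thesis using S that(2) by blast
  qed (use S that in blast)
  have "mult_image G n S = S \<inter> mult_image G n (carrier G)" for n
  \<comment> \<open>The exponent 0 makes every element a root of the identity, so
    \<open>root\<close> cannot cover it; here both sides collapse to the identity alone.\<close>
  proof (cases "n = 0")
    case True
    then show ?thesis using subgroup.one_closed[OF sub] by (auto simp: mult_image_def)
  next
    case False
    show ?thesis unfolding mult_image_def
      using root[OF False] subgroup.mem_carrier[OF sub] subgroup_int_pow_closed[OF sub] by blast
  qed
  then show "pure_subgroup S G" using sub by (simp add: pure_subgroup_def)
qed

lemma (in group) subgroup_Union_directed:
  assumes "F \<noteq> {}" "\<And>S. S \<in> F \<Longrightarrow> subgroup S G"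
    and dir: "\<And>S T. S \<in> F \<Longrightarrow> T \<in> F \<Longrightarrow> \<exists>U\<in>F. S \<union> T \<subseteq> U"
  shows "subgroup (\<Union>F) G"
proof (rule subgroupI)
  show "\<Union>F \<subseteq> carrier G" using assms(2) by (auto dest: subgroup.mem_carrier)
  show "\<Union>F \<noteq> {}" using assms(1,2) by (auto dest: subgroup.one_closed)
  fix a assume "a \<in> \<Union>F"
  then obtain S where S: "S \<in> F" "a \<in> S" by blast
  then show "inv a \<in> \<Union>F" using subgroup.m_inv_closed[OF assms(2)] by auto
  fix b assume "b \<in> \<Union>F"
  then obtain T where T: "T \<in> F" "b \<in> T" by blast
  obtain U where "U \<in> F" "S \<union> T \<subseteq> U" using dir[OF S(1) T(1)] by blast
  then show "a \<otimes> b \<in> \<Union>F" using subgroup.m_closed[OF assms(2)] S(2) T(2) by blast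
qed

section \<open>The sets \<open>p_omega\<close> under homomorphisms and in pure substructures\<close>

lemma p_omega_hom:
  assumes "group G" "group H" "f \<in> hom G H" "x \<in> p_omega p G"
  shows "f x \<in> p_omega p H"
  unfolding p_omega_def
proof
  interpret h: group_hom G H f
    using assms by (simp add: group_hom_def group_hom_axioms_def)
  fix n :: nat
  obtain y where "y \<in> carrier G" "x = y [^]\<^bsub>G\<^esub> (int p ^ n)"
    using assms(4) by (auto simp: p_omega_def mult_image_def)
  then show "f x \<in> mult_image H (int p ^ n) (carrier H)"
    by (auto simp: mult_image_def h.hom_int_pow)
qed

lemma p_omega_subset:
  assumes "group G"
  shows "p_omega p G \<subseteq> carrier G"
proof
  fix x assume "x \<in> p_omega p G"
  then have "x \<in> mult_image G (int p ^ 0) (carrier G)" unfolding p_omega_def by blast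
  then show "x \<in> carrier G" using group.int_pow_closed[OF assms] by (auto simp: mult_image_def)
qed

lemma one_in_p_omega:
  assumes "group G"
  shows "\<one>\<^bsub>G\<^esub> \<in> p_omega p G"
proof -
  interpret group G by fact
  show ?thesis unfolding p_omega_def mult_image_def by (auto intro!: image_eqI[of _ _ "\<one>\<^bsub>G\<^esub>"])
qed

lemma p_omega_int_pow:
  assumes "comm_group G" "x \<in> p_omega p G"
  shows "x [^]\<^bsub>G\<^esub> (k::int) \<in> p_omega p G"
\<comment> \<open>In an abelian group the power map is an endomorphism, and endomorphisms preserve
  \<open>p_omega\<close>.\<close>
proof (rule p_omega_hom[OF _ _ _ assms(2)])
  interpret comm_group G by fact
  show "group G" "group G" by unfold_locales
  show "(\<lambda>x. x [^]\<^bsub>G\<^esub> k) \<in> hom G G" by (auto simp: hom_def int_pow_distrib)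
qed

lemma pure_le_restrict: "pure_subgroup S N \<Longrightarrow> N\<lparr>carrier := S\<rparr> \<le>\<^sub>p N"
  by (simp add: pure_le_def)

lemma pure_le_incl_hom: "M \<le>\<^sub>p N \<Longrightarrow> id \<in> hom M N"
  unfolding pure_le_def pure_subgroup_def by (auto simp: hom_def dest: subgroup.mem_carrier)

lemma pure_le_int_pow:
  assumes "group M" "group N" "M \<le>\<^sub>p N" "x \<in> carrier M"
  shows "x [^]\<^bsub>M\<^esub> (n::int) = x [^]\<^bsub>N\<^esub> n"
proof -
  interpret h: group_hom M N id
    using assms pure_le_incl_hom by (simp add: group_hom_def group_hom_axioms_def)
  show ?thesis using h.hom_int_pow[OF assms(4)] by simp
qed

text \<open>Purity gives this trace property for each single power of \<open>p\<close>, and it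
  passes to the intersection over all powers. It allows membership of \<open>M\<close> in the class
  to be tested inside \<open>N\<close>.\<close>

lemma pure_le_p_omega:
  assumes "group M" "group N" "M \<le>\<^sub>p N"
  shows "p_omega p M = carrier M \<inter> p_omega p N"
proof -
  have "mult_image M n (carrier M) = carrier M \<inter> mult_image N n (carrier N)" for n
    using pure_le_int_pow[OF assms] assms(3)
    by (auto simp: pure_le_def pure_subgroup_def mult_image_def)
  then show ?thesis unfolding p_omega_def by auto
qed

lemma pure_le_comm_group:
  assumes "comm_group N" "M \<le>\<^sub>p N"
  shows "comm_group M"
proof -
  interpret N: comm_group N by fact
  have sub: "subgroup (carrier M) N" using assms(2) by (simp add: pure_le_def pure_subgroup_def)
  note [simp] = subgroup.mem_carrier[OF sub]
  have one: "\<one>\<^bsub>M\<^esub> = \<one>\<^bsub>N\<^esub>" and mult: "\<And>x y. x \<in> carrier M \<Longrightarrow> y \<in> carrier M \<Longrightarrow> x \<otimes>\<^bsub>M\<^esub> y = x \<otimes>\<^bsub>N\<^esub> y"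
    using assms(2) by (auto simp: pure_le_def)
  show ?thesis
  proof (rule comm_groupI)
    fix x assume x: "x \<in> carrier M"
    show "\<exists>y\<in>carrier M. y \<otimes>\<^bsub>M\<^esub> x = \<one>\<^bsub>M\<^esub>"
      using x subgroup.m_inv_closed[OF sub x] by (intro bexI[of _ "inv\<^bsub>N\<^esub> x"]) (auto simp: one mult)
  qed (use subgroup.one_closed[OF sub] subgroup.m_closed[OF sub] in
       \<open>auto simp: one mult N.m_ac\<close>)
qed

lemma pure_le_torsion_free:
  assumes "group M" "group N" "M \<le>\<^sub>p N" "torsion_free N"
  shows "torsion_free M"
  unfolding torsion_free_def
proof (intro ballI allI impI)
  fix x and n :: int
  assume x: "x \<in> carrier M" "n > 0" "x [^]\<^bsub>M\<^esub> n = \<one>\<^bsub>M\<^esub>"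
  have "x \<in> carrier N" "\<one>\<^bsub>M\<^esub> = \<one>\<^bsub>N\<^esub>"
    using assms(3) x(1) by (auto simp: pure_le_def pure_subgroup_def dest: subgroup.mem_carrier)
  then show "x = \<one>\<^bsub>M\<^esub>"
    using torsion_freeD[OF assms(4) _ x(2)] x pure_le_int_pow[OF assms(1-3) x(1)] by metis
qed

section \<open>Closed subsets\<close>

context
  fixes p1 p3 p4 :: nat
  assumes p3: "prime p3" "p3 \<noteq> p1"
begin

abbreviation (input) K :: "'a monoid set" where
  "K \<equiv> K_hat p1 p3 p4"

text \<open>The defining condition of \<open>K1_hat\<close> read in the ambient group. An inclusion
  in the trivial set, rather than an equality, makes the condition pass to arbitrary
  subsets.\<close>

definition K1_on :: "'a monoid \<Rightarrow> 'a set \<Rightarrow> bool" where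
  "K1_on N S \<longleftrightarrow> S \<subseteq> p_omega p1 N \<and>
     (\<forall>p::nat. prime p \<longrightarrow> p \<noteq> p1 \<longrightarrow> S \<inter> p_omega p N \<subseteq> {\<one>\<^bsub>N\<^esub>})"

text \<open>Only the existence condition (b) of \<open>K2_hat\<close> is relativized to
  \<open>S\<close>; the uniqueness condition (a) is inherited from the ambient group.\<close>

definition solvable_on :: "'a monoid \<Rightarrow> 'a set \<Rightarrow> bool" where
  "solvable_on N S \<longleftrightarrow> (\<forall>g\<in>S \<inter> p_omega p1 N. \<exists>k::int. k > 0 \<and>
     (\<exists>z\<in>S \<inter> p_omega p3 N. (g [^]\<^bsub>N\<^esub> k) \<otimes>\<^bsub>N\<^esub> z \<in> p_omega p4 N))"

definition closed_in :: "'a monoid \<Rightarrow> 'a set \<Rightarrow> bool" where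
  "closed_in N S \<longleftrightarrow> pure_subgroup S N \<and> (K1_on N S \<or> solvable_on N S)"

definition hull :: "'a monoid \<Rightarrow> 'a set \<Rightarrow> 'a set" where
  "hull N A = \<Inter>{S. closed_in N S \<and> A \<subseteq> S}"

lemma K1_on_antimono: "K1_on N T \<Longrightarrow> S \<subseteq> T \<Longrightarrow> K1_on N S"
  unfolding K1_on_def by blast

lemma K_comm_group: "N \<in> K \<Longrightarrow> comm_group N"
  and K_torsion_free: "N \<in> K \<Longrightarrow> torsion_free N"
  by (auto simp: K_hat_def K1_hat_def K2_hat_def)

lemma K_group: "N \<in> K \<Longrightarrow> group N"
  using K_comm_group comm_group.axioms(2) by blast

text \<open>Treats both subclasses at once: in the first, \<open>p3\<close> differs from
  \<open>p1\<close>, so both candidates lie in a trivial \<open>p_omega p3 N\<close>.\<close>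

lemma K_unique:
  assumes "N \<in> K" "g \<in> p_omega p1 N" "z \<in> p_omega p3 N" "z' \<in> p_omega p3 N"
    "g \<otimes>\<^bsub>N\<^esub> z \<in> p_omega p4 N" "g \<otimes>\<^bsub>N\<^esub> z' \<in> p_omega p4 N"
  shows "z = z'"
proof (cases "N \<in> K1_hat p1")
  case True
  then have "p_omega p3 N = {\<one>\<^bsub>N\<^esub>}" using p3 by (simp add: K1_hat_def)
  then show ?thesis using assms by simp
next
  case False
  then show ?thesis using assms unfolding K_hat_def K2_hat_def by blast
qed

text \<open>Commutativity, torsion-freeness and uniqueness all descend from \<open>N\<close> to
  \<open>M\<close>, and each \<open>p_omega\<close> of \<open>M\<close> is the trace of that of
  \<open>N\<close>. What remains of class membership depends only on the carrier of
  \<open>M\<close>.\<close>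

lemma pure_le_in_K_iff:
  assumes N: "N \<in> K" and le: "M \<le>\<^sub>p N"
  shows "M \<in> K \<longleftrightarrow> closed_in N (carrier M)"
proof -
  have gN: "group N" using N by (rule K_group)
  have cM: "comm_group M" using pure_le_comm_group K_comm_group[OF N] le by blast
  then have gM: "group M" by (rule comm_group.axioms(2))
  have tM: "torsion_free M" using pure_le_torsion_free[OF gM gN le] K_torsion_free[OF N] by blast
  have pure: "pure_subgroup (carrier M) N" and one: "\<one>\<^bsub>M\<^esub> = \<one>\<^bsub>N\<^esub>"
    and mult: "\<And>x y. x \<in> carrier M \<Longrightarrow> y \<in> carrier M \<Longrightarrow> x \<otimes>\<^bsub>M\<^esub> y = x \<otimes>\<^bsub>N\<^esub> y"
    using le by (auto simp: pure_le_def)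
  note om = pure_le_p_omega[OF gM gN le]
  have one_om: "\<one>\<^bsub>N\<^esub> \<in> carrier M \<inter> p_omega p N" for p
    using one_in_p_omega[OF gM, of p] by (simp add: om one)
  have 1: "M \<in> K1_hat p1 \<longleftrightarrow> K1_on N (carrier M)"
    unfolding K1_hat_def K1_on_def using cM tM one_om
    by (auto simp: om one)
  have uniq: "\<forall>g\<in>p_omega p1 M. \<forall>z\<in>p_omega p3 M. \<forall>z'\<in>p_omega p3 M.
        g \<otimes>\<^bsub>M\<^esub> z \<in> p_omega p4 M \<longrightarrow> g \<otimes>\<^bsub>M\<^esub> z' \<in> p_omega p4 M \<longrightarrow> z = z'"
    using K_unique[OF N] by (auto simp: om mult)
  have pow: "g [^]\<^bsub>M\<^esub> k = g [^]\<^bsub>N\<^esub> k" "g [^]\<^bsub>N\<^esub> k \<in> carrier M" if "g \<in> carrier M" for g and k :: int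
    using pure_le_int_pow[OF gM gN le that] group.int_pow_closed[OF gM that] by auto
  have eq: "(g [^]\<^bsub>M\<^esub> k) \<otimes>\<^bsub>M\<^esub> z \<in> p_omega p4 M \<longleftrightarrow> (g [^]\<^bsub>N\<^esub> k) \<otimes>\<^bsub>N\<^esub> z \<in> p_omega p4 N"
    if "g \<in> carrier M" "z \<in> carrier M" for g z and k :: int
    using that pow[OF that(1)] monoid.m_closed[OF group.is_monoid[OF gM], of "g [^]\<^bsub>N\<^esub> k" z]
    by (simp add: om mult)
  have 2: "M \<in> K2_hat p1 p3 p4 \<longleftrightarrow> solvable_on N (carrier M)"
    unfolding K2_hat_def solvable_on_def using cM tM uniq eq by (auto simp: om)
  show ?thesis using 1 2 pure by (auto simp: K_hat_def closed_in_def)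
qed

lemma restrict_in_K:
  assumes "N \<in> K" "closed_in N S"
  shows "N\<lparr>carrier := S\<rparr> \<in> K"
  using pure_le_in_K_iff[OF assms(1) pure_le_restrict] assms(2)
  by (simp add: closed_in_def)

lemma cl_eq_hull:
  assumes "N \<in> K"
  shows "cl K pure_le N A = N\<lparr>carrier := hull N A\<rparr>"
proof -
  have "{carrier M | M. M \<in> K \<and> M \<le>\<^sub>p N \<and> A \<subseteq> carrier M} = {S. closed_in N S \<and> A \<subseteq> S}"
  proof (intro Set.set_eqI iffI)
    \<comment> \<open>A closed set is realized as a carrier by restricting \<open>N\<close> itself
      to it.\<close>
    fix S assume "S \<in> {S. closed_in N S \<and> A \<subseteq> S}"
    then have "N\<lparr>carrier := S\<rparr> \<in> K" "N\<lparr>carrier := S\<rparr> \<le>\<^sub>p N" "A \<subseteq> S"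
      using restrict_in_K[OF assms] pure_le_restrict by (auto simp: closed_in_def)
    then show "S \<in> {carrier M | M. M \<in> K \<and> M \<le>\<^sub>p N \<and> A \<subseteq> carrier M}"
      by (auto intro!: exI[of _ "N\<lparr>carrier := S\<rparr>"])
  qed (use pure_le_in_K_iff[OF assms] in auto)
  then show ?thesis by (simp add: cl_def hull_def)
qed

section \<open>Intersections and directed unions of closed subsets\<close>

lemma closed_in_carrier:
  assumes "N \<in> K"
  shows "closed_in N (carrier N)"
proof -
  interpret comm_group N using assms by (rule K_comm_group)
  have "N \<le>\<^sub>p N"
    unfolding pure_le_def using pure_subgroup_iff[OF K_torsion_free[OF assms]] subgroup_self by simp
  then show ?thesis using pure_le_in_K_iff assms by blast
qed

text \<open>A single member of the first kind settles the matter, since that condition passes to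
  subsets. If there is none, all members are solvable, and uniqueness forces a solution found in one
  member into all the others.\<close>

lemma closed_in_Inter:
  assumes N: "N \<in> K" and "F \<noteq> {}" and F: "\<And>S. S \<in> F \<Longrightarrow> closed_in N S"
  shows "closed_in N (\<Inter>F)"
proof -
  interpret comm_group N using N by (rule K_comm_group)
  note tf = K_torsion_free[OF N]
  note pure = pure_subgroup_iff[OF tf]
  have FP: "pure_subgroup S N" if "S \<in> F" for S using F[OF that] by (simp add: closed_in_def)
  have sub: "subgroup (\<Inter>F) N"
    using FP \<open>F \<noteq> {}\<close> by (intro subgroups_Inter) (auto simp: pure)
  have "pure_subgroup (\<Inter>F) N" using FP sub unfolding pure by blast
  moreover have "K1_on N (\<Inter>F) \<or> solvable_on N (\<Inter>F)"
  proof (cases "\<exists>S\<in>F. K1_on N S")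
    case True
    then show ?thesis using K1_on_antimono by blast
  next
    case False
    then have solv: "solvable_on N S" if "S \<in> F" for S using F that by (auto simp: closed_in_def)
    have "solvable_on N (\<Inter>F)" unfolding solvable_on_def
    proof
      fix g assume g: "g \<in> \<Inter>F \<inter> p_omega p1 N"
      then have gc: "g \<in> carrier N" using p_omega_subset[OF is_group] by blast
      obtain S0 where S0: "S0 \<in> F" using \<open>F \<noteq> {}\<close> by blast
      then obtain k :: int and z where kz: "k > 0" "z \<in> p_omega p3 N"
          "g [^]\<^bsub>N\<^esub> k \<otimes>\<^bsub>N\<^esub> z \<in> p_omega p4 N"
        using solv[OF S0] g unfolding solvable_on_def by blast
      then have zc: "z \<in> carrier N" using p_omega_subset[OF is_group] by blast
      have "z \<in> S" if S: "S \<in> F" for S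
      proof -
        obtain l :: int and w where lw: "l > 0" "w \<in> S" "w \<in> p_omega p3 N"
            "g [^]\<^bsub>N\<^esub> l \<otimes>\<^bsub>N\<^esub> w \<in> p_omega p4 N"
          using solv[OF S] g S unfolding solvable_on_def by blast
        then have wc: "w \<in> carrier N" using p_omega_subset[OF is_group] by blast
        \<comment> \<open>The multipliers \<open>k\<close> and \<open>l\<close> may differ, so both
          solutions are raised to the common exponent \<open>k * l\<close> on \<open>g\<close>.
          Uniqueness then equates \<open>z\<close> to the power \<open>l\<close> with
          \<open>w\<close> to the power \<open>k\<close>, an element of \<open>S\<close>, and purity
          extracts the root \<open>z\<close>.\<close>
        note powom = p_omega_int_pow[OF comm_group_axioms]
        have a: "g [^]\<^bsub>N\<^esub> (k * l) \<otimes>\<^bsub>N\<^esub> z [^]\<^bsub>N\<^esub> l \<in> p_omega p4 N"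
          using powom[OF kz(3), of l] gc zc by (simp add: int_pow_distrib int_pow_pow)
        have b: "g [^]\<^bsub>N\<^esub> (k * l) \<otimes>\<^bsub>N\<^esub> w [^]\<^bsub>N\<^esub> k \<in> p_omega p4 N"
          using powom[OF lw(4), of k] gc wc by (simp add: int_pow_distrib int_pow_pow mult.commute)
        have "z [^]\<^bsub>N\<^esub> l = w [^]\<^bsub>N\<^esub> k"
          using K_unique[OF N powom powom[OF kz(2)] powom[OF lw(3)] a b] g by blast
        moreover have "w [^]\<^bsub>N\<^esub> k \<in> S"
          using subgroup_int_pow_closed FP[OF S] lw(2) by (auto simp: pure)
        ultimately show "z \<in> S" using FP[OF S] lw(1) zc by (auto simp: pure)
      qed
      then show "\<exists>k::int. k > 0 \<and> (\<exists>z\<in>\<Inter>F \<inter> p_omega p3 N. g [^]\<^bsub>N\<^esub> k \<otimes>\<^bsub>N\<^esub> z \<in> p_omega p4 N)"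
        using kz by blast
    qed
    then show ?thesis ..
  qed
  ultimately show ?thesis by (simp add: closed_in_def)
qed

text \<open>If every member satisfies the first condition, so does the union, as the condition is
  elementwise. Otherwise some \<open>S0\<close> violates it, hence so does every member above
  \<open>S0\<close>; these members are therefore solvable, and by directedness they exhaust the
  union.\<close>

lemma closed_in_Union_directed:
  assumes N: "N \<in> K" and "F \<noteq> {}" and F: "\<And>S. S \<in> F \<Longrightarrow> closed_in N S"
    and dir: "\<And>S T. S \<in> F \<Longrightarrow> T \<in> F \<Longrightarrow> \<exists>U\<in>F. S \<union> T \<subseteq> U"
  shows "closed_in N (\<Union>F)"
proof -
  interpret comm_group N using N by (rule K_comm_group)
  note pure = pure_subgroup_iff[OF K_torsion_free[OF N]]
  have FP: "pure_subgroup S N" if "S \<in> F" for S using F[OF that] by (simp add: closed_in_def)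
  have "subgroup (\<Union>F) N"
    using FP \<open>F \<noteq> {}\<close> dir by (intro subgroup_Union_directed) (auto simp: pure)
  then have "pure_subgroup (\<Union>F) N" using FP unfolding pure by blast
  moreover have "K1_on N (\<Union>F) \<or> solvable_on N (\<Union>F)"
  proof (cases "\<forall>S\<in>F. K1_on N S")
    case True
    then have "K1_on N (\<Union>F)" unfolding K1_on_def by blast
    then show ?thesis ..
  next
    case False
    then obtain S0 where S0: "S0 \<in> F" "\<not> K1_on N S0" by blast
    have "solvable_on N (\<Union>F)" unfolding solvable_on_def
    proof
      fix g assume g: "g \<in> \<Union>F \<inter> p_omega p1 N"
      then obtain S where "S \<in> F" "g \<in> S" by blast
      then obtain U where U: "U \<in> F" "S0 \<subseteq> U" "g \<in> U" using dir[OF S0(1)] by blast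
      then have "solvable_on N U" using F[OF U(1)] K1_on_antimono S0 by (auto simp: closed_in_def)
      then show "\<exists>k::int. k > 0 \<and> (\<exists>z\<in>\<Union>F \<inter> p_omega p3 N. g [^]\<^bsub>N\<^esub> k \<otimes>\<^bsub>N\<^esub> z \<in> p_omega p4 N)"
        using g U unfolding solvable_on_def by blast
    qed
    then show ?thesis ..
  qed
  ultimately show ?thesis by (simp add: closed_in_def)
qed

lemma closed_in_hull:
  assumes "N \<in> K" "A \<subseteq> carrier N"
  shows "closed_in N (hull N A)"
  unfolding hull_def using closed_in_carrier assms by (intro closed_in_Inter) auto

lemma hull_minimal: "closed_in N S \<Longrightarrow> A \<subseteq> S \<Longrightarrow> hull N A \<subseteq> S"
  unfolding hull_def by blast

lemma hull_superset: "A \<subseteq> hull N A"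
  unfolding hull_def by blast

lemma hull_mono: "A \<subseteq> B \<Longrightarrow> hull N A \<subseteq> hull N B"
  unfolding hull_def by blast

lemma hull_subset_carrier: "N \<in> K \<Longrightarrow> A \<subseteq> carrier N \<Longrightarrow> hull N A \<subseteq> carrier N"
  by (intro hull_minimal closed_in_carrier)

section \<open>Rigidity and finite character of the closure\<close>

text \<open>The engine of rigidity. A closed set through which two homomorphisms agree on
  \<open>A\<close> must contain the closure of \<open>A\<close>, so it suffices that agreement
  spreads to roots and to solutions \<open>z\<close>.\<close>

lemma closed_in_equalizer:
  assumes N: "N \<in> K" "N' \<in> K" and C: "closed_in N C"
    and f: "f \<in> hom (N\<lparr>carrier := C\<rparr>) N'" and g: "g \<in> hom (N\<lparr>carrier := C\<rparr>) N'"
  shows "closed_in N {x \<in> C. f x = g x}"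
proof -
  let ?C = "N\<lparr>carrier := C\<rparr>" and ?E = "{x \<in> C. f x = g x}"
  interpret N: comm_group N using N(1) by (rule K_comm_group)
  interpret N': comm_group N' using N(2) by (rule K_comm_group)
  have C_pure: "pure_subgroup C N" using C by (simp add: closed_in_def)
  have le: "?C \<le>\<^sub>p N" using C_pure by (rule pure_le_restrict)
  have CK: "?C \<in> K" using N(1) C by (rule restrict_in_K)
  interpret C: comm_group ?C using CK by (rule K_comm_group)
  interpret f: group_hom ?C N' f using f by unfold_locales
  interpret g: group_hom ?C N' g using g by unfold_locales
  note pure = N.pure_subgroup_iff[OF K_torsion_free[OF N(1)]]
  have sub: "subgroup C N" using C_pure by (simp add: pure)
  note om = pure_le_p_omega[OF C.is_group N.is_group le, simplified]
  have pow: "x [^]\<^bsub>?C\<^esub> n = x [^]\<^bsub>N\<^esub> n" if "x \<in> C" for x and n :: int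
    using pure_le_int_pow[OF C.is_group N.is_group le] that by simp
  have f_pow: "f (x [^]\<^bsub>N\<^esub> n) = f x [^]\<^bsub>N'\<^esub> n" if "x \<in> C" for x and n :: int
    using f.hom_int_pow[of x n] that pow[OF that, of n] by simp
  have g_pow: "g (x [^]\<^bsub>N\<^esub> n) = g x [^]\<^bsub>N'\<^esub> n" if "x \<in> C" for x and n :: int
    using g.hom_int_pow[of x n] that pow[OF that, of n] by simp
  have fc: "f x \<in> carrier N'" and gc: "g x \<in> carrier N'" if "x \<in> C" for x
    using f.hom_closed[of x] g.hom_closed[of x] that by auto
  have f_mult: "f (x \<otimes>\<^bsub>N\<^esub> y) = f x \<otimes>\<^bsub>N'\<^esub> f y" and g_mult: "g (x \<otimes>\<^bsub>N\<^esub> y) = g x \<otimes>\<^bsub>N'\<^esub> g y"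
    if "x \<in> C" "y \<in> C" for x y
    using f.hom_mult[of x y] g.hom_mult[of x y] that by auto
  \<comment> \<open>The maps are defined only on \<open>C\<close>, so the roots of \<open>x\<close>
    must be found there; purity of \<open>C\<close> supplies them through \<open>om\<close>.\<close>
  have f_om: "f x \<in> p_omega p N'" and g_om: "g x \<in> p_omega p N'" if "x \<in> C" "x \<in> p_omega p N" for x p
    using p_omega_hom[OF C.is_group N'.is_group f] p_omega_hom[OF C.is_group N'.is_group g] that
    by (auto simp: om)
  have sub_E: "subgroup ?E N"
  proof (rule N.subgroupI)
    show "?E \<subseteq> carrier N" using subgroup.subset[OF sub] by blast
    show "?E \<noteq> {}" using subgroup.one_closed[OF sub] f.hom_one g.hom_one by auto
    fix a assume a: "a \<in> ?E"
    \<comment> \<open>Writing the inverse as a power lets \<open>f_pow\<close> and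
      \<open>g_pow\<close> apply, which avoids comparing inverses in \<open>N\<close> with those in
      its restriction.\<close>
    have "inv\<^bsub>N\<^esub> a = a [^]\<^bsub>N\<^esub> (-1::int)"
      using a subgroup.mem_carrier[OF sub] by (simp add: N.int_pow_neg N.int_pow_1)
    then show "inv\<^bsub>N\<^esub> a \<in> ?E"
      using a subgroup.m_inv_closed[OF sub, of a] f_pow[of a "-1"] g_pow[of a "-1"] by auto
    show "a \<otimes>\<^bsub>N\<^esub> b \<in> ?E" if "b \<in> ?E" for b
      using a that subgroup.m_closed[OF sub] f_mult g_mult by auto
  qed
  have "pure_subgroup ?E N"
    unfolding pure
  proof (intro conjI allI impI ballI sub_E)
    fix n :: int and y assume y: "0 < n" "y \<in> carrier N" "y [^]\<^bsub>N\<^esub> n \<in> ?E"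
    then have yC: "y \<in> C" using C_pure by (auto simp: pure)
    have "f y [^]\<^bsub>N'\<^esub> n = g y [^]\<^bsub>N'\<^esub> n" using y(3) f_pow[OF yC] g_pow[OF yC] by simp
    then show "y \<in> ?E"
      using N'.torsion_free_pow_inj[OF K_torsion_free[OF N(2)] fc[OF yC] gc[OF yC] y(1)] yC by blast
  qed
  moreover have "K1_on N ?E \<or> solvable_on N ?E"
  proof (cases "K1_on N C")
    case True
    then have "K1_on N ?E" by (rule K1_on_antimono) blast
    then show ?thesis ..
  next
    case False
    then have solv: "solvable_on N C" using C by (simp add: closed_in_def)
    have "solvable_on N ?E" unfolding solvable_on_def
    proof
      fix x assume x: "x \<in> ?E \<inter> p_omega p1 N"
      then obtain k :: int and z where kz: "k > 0" "z \<in> C" "z \<in> p_omega p3 N"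
          "x [^]\<^bsub>N\<^esub> k \<otimes>\<^bsub>N\<^esub> z \<in> p_omega p4 N"
        using solv unfolding solvable_on_def by blast
      have xk: "x [^]\<^bsub>N\<^esub> k \<in> C" using x N.subgroup_int_pow_closed[OF sub] by auto
      then have sum: "x [^]\<^bsub>N\<^esub> k \<otimes>\<^bsub>N\<^esub> z \<in> C" using kz(2) subgroup.m_closed[OF sub] by blast
      have feq: "f (x [^]\<^bsub>N\<^esub> k) = g (x [^]\<^bsub>N\<^esub> k)" using x f_pow g_pow by auto
      have "x [^]\<^bsub>N\<^esub> k \<in> p_omega p1 N"
        using x p_omega_int_pow[OF N.comm_group_axioms] by blast
      then have "f (x [^]\<^bsub>N\<^esub> k) \<in> p_omega p1 N'" using f_om[OF xk] by blast
      \<comment> \<open>Both \<open>f z\<close> and \<open>g z\<close> solve the same problem in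
        \<open>N'\<close>, posed by the common image of the power of \<open>x\<close>, so uniqueness
        in \<open>N'\<close> identifies them.\<close>
      then have "f z = g z"
        using K_unique[OF N(2) _ f_om[OF kz(2,3)] g_om[OF kz(2,3)]]
          f_om[OF sum kz(4)] g_om[OF sum kz(4)] feq f_mult[OF xk kz(2)] g_mult[OF xk kz(2)] by simp
      then show "\<exists>k::int. k > 0 \<and> (\<exists>z\<in>?E \<inter> p_omega p3 N. x [^]\<^bsub>N\<^esub> k \<otimes>\<^bsub>N\<^esub> z \<in> p_omega p4 N)"
        using kz by blast
    qed
    then show ?thesis ..
  qed
  ultimately show ?thesis by (simp add: closed_in_def)
qed

lemma hull_rigid:
  assumes "N \<in> K" "N' \<in> K" "A \<subseteq> carrier N"
    and "f \<in> hom (N\<lparr>carrier := hull N A\<rparr>) N'" "g \<in> hom (N\<lparr>carrier := hull N A\<rparr>) N'"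
    and "\<And>a. a \<in> A \<Longrightarrow> f a = g a" and "x \<in> hull N A"
  shows "f x = g x"
proof -
  have "A \<subseteq> {x \<in> hull N A. f x = g x}"
    using assms(6) hull_superset[of A N] by blast
  with closed_in_equalizer[OF assms(1,2) closed_in_hull[OF assms(1,3)] assms(4,5)]
  have "hull N A \<subseteq> {x \<in> hull N A. f x = g x}" by (rule hull_minimal)
  then show ?thesis using assms(7) by blast
qed

text \<open>The closures of finite subsets form a directed family, so their union is closed and
  contains the generators. The element \<open>b\<close> is kept in every stage to match the closures
  occurring in \<open>gtp_eq\<close>.\<close>

lemma hull_insert_finitary:
  assumes N: "N \<in> K" and "b \<in> carrier N" "X \<subseteq> carrier N"
  shows "hull N (insert b X) = (\<Union>A\<in>{A. finite A \<and> A \<subseteq> X}. hull N (insert b A))"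
proof
  let ?F = "(\<lambda>A. hull N (insert b A)) ` {A. finite A \<and> A \<subseteq> X}"
  have "closed_in N (\<Union>?F)"
  proof (rule closed_in_Union_directed[OF N])
    show "?F \<noteq> {}" by auto
    show "closed_in N S" if "S \<in> ?F" for S
    proof -
      obtain A where "A \<subseteq> X" "S = hull N (insert b A)" using \<open>S \<in> ?F\<close> by blast
      then show ?thesis using assms closed_in_hull[OF N, of "insert b A"] by auto
    qed
    fix S T assume "S \<in> ?F" "T \<in> ?F"
    then obtain A B where AB: "finite A" "A \<subseteq> X" "S = hull N (insert b A)"
        "finite B" "B \<subseteq> X" "T = hull N (insert b B)" by auto
    show "\<exists>U\<in>?F. S \<union> T \<subseteq> U"
    proof (intro bexI)
      show "S \<union> T \<subseteq> hull N (insert b (A \<union> B))"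
        unfolding AB(3,6) by (intro Un_least hull_mono insert_mono Un_upper1 Un_upper2)
      show "hull N (insert b (A \<union> B)) \<in> ?F" using AB by (intro imageI) simp
    qed
  qed
  moreover have "insert b X \<subseteq> \<Union>?F"
  proof
    fix x assume "x \<in> insert b X"
    \<comment> \<open>The finite set \<open>{x} \<inter> X\<close> serves both cases: it is
      \<open>{x}\<close> when \<open>x\<close> lies in \<open>X\<close>, and empty otherwise, when
      \<open>x\<close> is \<open>b\<close>.\<close>
    then have "x \<in> insert b ({x} \<inter> X)" by auto
    then have "x \<in> hull N (insert b ({x} \<inter> X))" by (rule subsetD[OF hull_superset])
    then show "x \<in> \<Union>?F" by (intro UN_I[of "{x} \<inter> X"]) simp_all
  qed
  ultimately show "hull N (insert b X) \<subseteq> \<Union>?F" by (rule hull_minimal)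
  show "\<Union>?F \<subseteq> hull N (insert b X)"
    by (intro UN_least hull_mono insert_mono) simp
qed

section \<open>Pseudo-universality and tameness\<close>

lemma iso_restrict_hom:
  assumes "f \<in> iso G (N\<lparr>carrier := C\<rparr>)" "C \<subseteq> carrier N"
  shows "f \<in> hom G N"
  using assms by (auto simp: iso_def hom_def)

lemma pseudo_universal_K: "pseudo_universal (K :: 'a monoid set) pure_le"
  unfolding pseudo_universal_def
proof (intro ballI allI impI)
  fix N1 N2 :: "'a monoid" and a1 a2 :: "'a list" and f g x
  assume N: "N1 \<in> K" "N2 \<in> K" and a: "set a1 \<subseteq> carrier N1" "set a2 \<subseteq> carrier N2"
    and f: "f \<in> iso (cl K pure_le N1 (set a1)) (cl K pure_le N2 (set a2))"
    and g: "g \<in> iso (cl K pure_le N1 (set a1)) (cl K pure_le N2 (set a2))"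
    and eq: "map f a1 = a2" "map g a1 = a2"
    and x: "x \<in> carrier (cl K pure_le N1 (set a1))"
  note cl = cl_eq_hull[OF N(1)] cl_eq_hull[OF N(2)]
  note hom = iso_restrict_hom[OF _ hull_subset_carrier[OF N(2) a(2)]]
  have "f a = g a" if "a \<in> set a1" for a using eq that by (metis map_eq_conv)
  then show "f x = g x"
    using hull_rigid[OF N a(1) hom[OF f[unfolded cl]] hom[OF g[unfolded cl]]] x by (simp add: cl)
qed

text \<open>An isomorphism is chosen for each finite subset. Rigidity makes these choices compatible
  along inclusions, so they glue to a map on the directed union of the finite stages, which is the
  full closure on either side.\<close>

lemma gtp_eq_finitary:
  assumes N: "N1 \<in> K" "N2 \<in> K" and b: "b1 \<in> carrier N1" "b2 \<in> carrier N2"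
    and X: "X \<subseteq> carrier N1" "X \<subseteq> carrier N2"
    and fin: "\<And>A. finite A \<Longrightarrow> A \<subseteq> X \<Longrightarrow> gtp_eq K pure_le A b1 N1 b2 N2"
  shows "gtp_eq K pure_le X b1 N1 b2 N2"
proof -
  let ?fin = "\<lambda>A. finite A \<and> A \<subseteq> X"
  define C where "C A = hull N1 (insert b1 A)" for A
  define D where "D A = hull N2 (insert b2 A)" for A
  note cl = cl_eq_hull[OF N(1)] cl_eq_hull[OF N(2)]
  have "\<forall>A. ?fin A \<longrightarrow> (\<exists>f. f \<in> iso (N1\<lparr>carrier := C A\<rparr>) (N2\<lparr>carrier := D A\<rparr>) \<and>
      (\<forall>a\<in>A. f a = a) \<and> f b1 = b2)"
  proof (intro allI impI)
    fix A assume "?fin A"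
    then show "\<exists>f. f \<in> iso (N1\<lparr>carrier := C A\<rparr>) (N2\<lparr>carrier := D A\<rparr>) \<and> (\<forall>a\<in>A. f a = a) \<and> f b1 = b2"
      using fin[of A] unfolding gtp_eq_def cl C_def D_def by blast
  qed
  then obtain F where F: "\<And>A. ?fin A \<Longrightarrow> F A \<in> iso (N1\<lparr>carrier := C A\<rparr>) (N2\<lparr>carrier := D A\<rparr>)"
      "\<And>A a. ?fin A \<Longrightarrow> a \<in> A \<Longrightarrow> F A a = a" "\<And>A. ?fin A \<Longrightarrow> F A b1 = b2"
    by metis
  have D_sub: "D A \<subseteq> carrier N2" if "A \<subseteq> X" for A
    unfolding D_def using b(2) X(2) that by (intro hull_subset_carrier[OF N(2)]) blast
  \<comment> \<open>Viewed as maps into all of \<open>N2\<close>, the isomorphisms for different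
    finite sets share a target and can be compared by rigidity.\<close>
  have F_hom: "F A \<in> hom (N1\<lparr>carrier := C A\<rparr>) N2" if "?fin A" for A
    using iso_restrict_hom[OF F(1)[OF that] D_sub] that by simp
  have F_bij: "bij_betw (F A) (C A) (D A)" if "?fin A" for A
    using F(1)[OF that] by (simp add: iso_def)
  have C_mono: "C A \<subseteq> C B" if "A \<subseteq> B" for A B
    unfolding C_def using that by (intro hull_mono) blast
  have mono: "F A x = F B x" if "?fin B" "A \<subseteq> B" "x \<in> C A" for A B x
  proof -
    have A: "?fin A" using that finite_subset[of A B] by auto
    show ?thesis
    proof (rule hull_rigid[OF N, where f = "F A" and g = "F B"])
      show "insert b1 A \<subseteq> carrier N1" using A b(1) X(1) by blast
      show "F A \<in> hom (N1\<lparr>carrier := hull N1 (insert b1 A)\<rparr>) N2"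
        using F_hom[OF A] by (simp only: C_def)
      have "F B \<in> hom (N1\<lparr>carrier := C A\<rparr>) N2"
        using F_hom[OF that(1)] C_mono[OF that(2)] by (auto simp: hom_def)
      then show "F B \<in> hom (N1\<lparr>carrier := hull N1 (insert b1 A)\<rparr>) N2"
        by (simp only: C_def)
      show "x \<in> hull N1 (insert b1 A)" using that(3) by (simp only: C_def)
      show "F A a = F B a" if "a \<in> insert b1 A" for a
        using that F(2)[OF A, of a] F(2)[OF \<open>?fin B\<close>, of a] F(3)[OF A] F(3)[OF \<open>?fin B\<close>] \<open>A \<subseteq> B\<close>
        by auto
    qed
  qed
  have CX: "C X = (\<Union>A\<in>{A. ?fin A}. C A)" and DX: "D X = (\<Union>A\<in>{A. ?fin A}. D A)"
    unfolding C_def D_def by (rule hull_insert_finitary; use N b X in blast)+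
  have CX_iff: "x \<in> C X \<longleftrightarrow> (\<exists>A. ?fin A \<and> x \<in> C A)" for x by (subst CX) simp
  have DX_iff: "y \<in> D X \<longleftrightarrow> (\<exists>A. ?fin A \<and> y \<in> D A)" for y by (subst DX) simp
  define h where "h x = F (SOME A. ?fin A \<and> x \<in> C A) x" for x
  \<comment> \<open>The value does not depend on the chosen stage: any two stages containing
    \<open>x\<close> embed in the stage of their union, where \<open>mono\<close> compares
    them.\<close>
  have h: "h x = F A x" if "?fin A" "x \<in> C A" for A x
  proof -
    let ?B = "SOME A. ?fin A \<and> x \<in> C A"
    have B: "?fin ?B \<and> x \<in> C ?B" by (rule someI[of _ A]) (use that in blast)
    then have "?fin (A \<union> ?B)" using that by blast
    then have "F A x = F (A \<union> ?B) x" "F ?B x = F (A \<union> ?B) x"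
      using mono[of "A \<union> ?B" A x] mono[of "A \<union> ?B" ?B x] that(2) B by simp_all
    then show ?thesis by (simp add: h_def)
  qed
  have pair: "\<exists>A. ?fin A \<and> x \<in> C A \<and> y \<in> C A" if xy: "x \<in> C X" "y \<in> C X" for x y
  proof -
    obtain A B where A: "?fin A" "x \<in> C A" and B: "?fin B" "y \<in> C B"
      using xy unfolding CX_iff by blast
    have "x \<in> C (A \<union> B)" by (rule subsetD[OF C_mono A(2)]) simp
    moreover have "y \<in> C (A \<union> B)" by (rule subsetD[OF C_mono B(2)]) simp
    ultimately show ?thesis using A(1) B(1) by (intro exI[of _ "A \<union> B"]) simp
  qed
  \<comment> \<open>Keeps a product in the same stage as its factors, so that \<open>h\<close> is
    computed on all three by one homomorphism \<open>F A\<close>.\<close>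
  have C_mult: "x \<otimes>\<^bsub>N1\<^esub> y \<in> C A" if "?fin A" "x \<in> C A" "y \<in> C A" for x y A
  proof -
    have "closed_in N1 (C A)"
      unfolding C_def using that b X by (intro closed_in_hull[OF N(1)]) blast
    then have "subgroup (C A) N1" by (simp add: closed_in_def pure_subgroup_def)
    then show ?thesis using that(2,3) by (rule subgroup.m_closed)
  qed
  have hD: "h x \<in> D X" if x: "x \<in> C X" for x
  proof -
    obtain A where A: "?fin A" "x \<in> C A" using x unfolding CX_iff by blast
    then have "h x \<in> D A" using h[OF A] bij_betwE[OF F_bij[OF A(1)]] by simp
    then show ?thesis unfolding DX_iff using A(1) by blast
  qed
  have "h \<in> iso (N1\<lparr>carrier := C X\<rparr>) (N2\<lparr>carrier := D X\<rparr>)"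
    unfolding iso_def hom_def
  proof (clarsimp simp: hD, intro conjI ballI)
    fix x y assume "x \<in> C X" "y \<in> C X"
    then obtain A where A: "?fin A" "x \<in> C A" "y \<in> C A" using pair by blast
    then show "h (x \<otimes>\<^bsub>N1\<^esub> y) = h x \<otimes>\<^bsub>N2\<^esub> h y"
      using h[OF A(1)] C_mult[OF A] F_hom[OF A(1)] by (simp add: hom_def)
  next
    have "inj_on h (C X)"
    proof (rule inj_onI)
      fix x y assume "x \<in> C X" "y \<in> C X" and eq: "h x = h y"
      then obtain A where A: "?fin A" "x \<in> C A" "y \<in> C A" using pair by blast
      then show "x = y" using eq h[OF A(1)] inj_onD[OF bij_betw_imp_inj_on[OF F_bij[OF A(1)]]] by simp
    qed
    moreover have "D X \<subseteq> h ` C X"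
    proof
      fix y assume "y \<in> D X"
      then obtain A where A: "?fin A" "y \<in> D A" unfolding DX_iff by blast
      then obtain x where x: "x \<in> C A" "y = F A x" using bij_betw_imp_surj_on[OF F_bij[OF A(1)]] by blast
      then have "x \<in> C X" unfolding CX_iff using A(1) by blast
      then show "y \<in> h ` C X" using x(2) h[OF A(1) x(1)] by (metis imageI)
    qed
    ultimately show "bij_betw h (C X) (D X)" using hD by (auto simp: bij_betw_def)
  qed
  moreover have "h a = a" if "a \<in> X" for a
  proof -
    have A: "?fin {a}" using that by simp
    have "a \<in> C {a}" unfolding C_def by (rule subsetD[OF hull_superset]) simp
    then show ?thesis using h[OF A] F(2)[OF A] by simp
  qed
  moreover have "h b1 = b2"
  proof -
    \<comment> \<open>The empty stage already contains \<open>b1\<close>, which is inserted at every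
      stage.\<close>
    have "b1 \<in> C {}" unfolding C_def by (rule subsetD[OF hull_superset]) simp
    then show ?thesis using h[of "{}"] F(3)[of "{}"] by simp
  qed
  ultimately show ?thesis unfolding gtp_eq_def cl C_def D_def by (intro bexI[of _ h]) simp_all
qed

text \<open>By contraposition, equality of types over every finite subset of
  \<open>carrier M\<close> glues to equality over \<open>carrier M\<close>.\<close>

lemma finitely_tame_K: "finitely_tame (K :: 'a monoid set) pure_le"
  unfolding finitely_tame_def
proof (intro ballI impI)
  fix M N1 N2 :: "'a monoid" and b1 b2
  assume N: "N1 \<in> K" "N2 \<in> K" and b: "b1 \<in> carrier N1" "b2 \<in> carrier N2"
    and M: "carrier M \<subseteq> carrier N1 \<inter> carrier N2"
    and ne: "\<not> gtp_eq K pure_le (carrier M) b1 N1 b2 N2"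
  show "\<exists>A. finite A \<and> A \<subseteq> carrier M \<and> \<not> gtp_eq K pure_le A b1 N1 b2 N2"
  proof (rule ccontr)
    assume "\<not> ?thesis"
    then have fin: "gtp_eq K pure_le A b1 N1 b2 N2" if "finite A" "A \<subseteq> carrier M" for A
      using that by simp
    have "carrier M \<subseteq> carrier N1" "carrier M \<subseteq> carrier N2" using M by simp_all
    then have "gtp_eq K pure_le (carrier M) b1 N1 b2 N2"
      using fin by (rule gtp_eq_finitary[OF N b])
    then show False using ne by simp
  qed
qed

end

theorem theorem3p9:
  fixes p1 p3 p4 :: nat
  assumes "prime p1" and "prime p3" and "prime p4"
    and "p1 \<noteq> p3" and "p1 \<noteq> p4" and "p3 \<noteq> p4"
  shows "pseudo_universal (K_hat p1 p3 p4 :: 'a monoid set) pure_le \<and>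
         finitely_tame (K_hat p1 p3 p4 :: 'a monoid set) pure_le"
  using pseudo_universal_K[of p3 p1 p4] finitely_tame_K[of p3 p1 p4] assms by simp

end
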